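(* For $n-1\le j\le n$, $$|R_{\theta,n;-2,-j;n-1}|=\tau_{-1}^{j-4}\left\{\tilde\tau_{-2}\left[(1+2w)^2u^4-1\right]+\tilde\tau_{-1}\tau_1^*\right\}|\tilde A_{\theta,n;n-j}|,$$ where $\tau_1^*=(1+w)u-(1+w)(1+2w)u^3$ and $|\tilde A_{\theta,n;0}|=1$.
   Context: Notation: $\theta$ is a strictly positive constant, $n$ is a positive integer, $w=\theta/n$, $u=e^{-w}$. $R_{\theta,n}$ is the $n\times n$ matrix with $(k,l)$th element $(1+|k-l|w)u^{|k-l|}$. For $1\le i,j\le n$, $R_{\theta,n;-i,-j}$ is the $(n-1)\times(n-1)$ matrix obtained from $R_{\theta,n}$ by deleting row $i$ and column $j$, and $R_{\theta,n;-i,-j;m}$ is its leading $m\times m$ submatrix, so that $R_{\theta,n;-i,-j;n-1}=R_{\theta,n;-i,-j}$. It is assumed throughout that $i\le j$ and $i\ge n-j+1$ (here $i=2$). $|M|$ denotes the determinant of a square matrix $M$. $\tau_{-2}=0$, $\tau_{-1}=(w-1)u+(1+w)u^3$, and $\tau_k=(1+kw)u^k-2[1+(k+1)w]u^{k+2}+[1+(k+2)w]u^{k+4}$ for $k\ge0$. $\tilde\tau_{-2}=\tau_{-1}u/2$ and $\tilde\tau_{-1}=\frac12\left[(2w-1)u+(1+2w)u^5\right]$. For $1\le m\le n-1$, $\tilde A_{\theta,n;m}$ is the $m\times m$ matrix whose $(k,l)$th entry is $\tau_{l-k}$ if $l\ge k-1$ and $0$ if $l\le k-2$ (so $\tilde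 A_{\theta,n;1}=(\tau_0)$).
   Formalization: The formal statement assumes j ≥ 4, so the exponent j−4 is nonnegative; for j = 2, 3 the identity as stated fails, e.g. for n = j = 2 the left side is 1 while the right side behaves like 9/w as w → 0. *)

theory Defs
  imports "Jordan_Normal_Form.Determinant" "Jordan_Normal_Form.DL_Submatrix"
begin

definition w_par :: "real \<Rightarrow> nat \<Rightarrow> real"
  where "w_par \<theta> n = \<theta> / real n"

definition u_par :: "real \<Rightarrow> nat \<Rightarrow> real"
  where "u_par \<theta> n = exp (- w_par \<theta> n)"

definition R_mat :: "real \<Rightarrow> nat \<Rightarrow> real mat" where
  "R_mat \<theta> n = mat n n (\<lambda>(k, l).
     (1 + of_int \<bar>int k - int l\<bar> * w_par \<theta> n) * u_par \<theta> n ^ nat \<bar>int k - int l\<bar>)"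

text \<open>The arguments \<open>i\<close> and \<open>j\<close> are 1-based, whereas matrix indices are 0-based.\<close>

definition R_minus :: "real \<Rightarrow> nat \<Rightarrow> nat \<Rightarrow> nat \<Rightarrow> real mat"
  where "R_minus \<theta> n i j = mat_delete (R_mat \<theta> n) (i - 1) (j - 1)"

definition R_minus_leading :: "real \<Rightarrow> nat \<Rightarrow> nat \<Rightarrow> nat \<Rightarrow> nat \<Rightarrow> real mat"
  where "R_minus_leading \<theta> n i j m = submatrix (R_minus \<theta> n i j) {..<m} {..<m}"

text \<open>Only the indices \<open>k \<ge> -2\<close> are meaningful; the value is \<open>0\<close> at \<open>-2\<close>
  and, as an irrelevant default, below it.\<close>

definition tau :: "real \<Rightarrow> nat \<Rightarrow> int \<Rightarrow> real" where
  "tau \<theta> n k = (let w = w_par \<theta> n; u = u_par \<theta> n in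
     if k \<ge> 0 then
       (1 + of_int k * w) * u ^ nat k
         - 2 * (1 + (of_int k + 1) * w) * u ^ (nat k + 2)
         + (1 + (of_int k + 2) * w) * u ^ (nat k + 4)
     else if k = -1 then (w - 1) * u + (1 + w) * u ^ 3
     else 0)"

definition tau_tilde_m2 :: "real \<Rightarrow> nat \<Rightarrow> real"
  where "tau_tilde_m2 \<theta> n = tau \<theta> n (-1) * u_par \<theta> n / 2"

definition tau_tilde_m1 :: "real \<Rightarrow> nat \<Rightarrow> real" where
  "tau_tilde_m1 \<theta> n = (let w = w_par \<theta> n; u = u_par \<theta> n in
     (1 / 2) * ((2 * w - 1) * u + (1 + 2 * w) * u ^ 5))"

definition tau_star_1 :: "real \<Rightarrow> nat \<Rightarrow> real" where
  "tau_star_1 \<theta> n = (let w = w_par \<theta> n; u = u_par \<theta> n in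
     (1 + w) * u - (1 + w) * (1 + 2 * w) * u ^ 3)"

definition A_tilde :: "real \<Rightarrow> nat \<Rightarrow> nat \<Rightarrow> real mat" where
  "A_tilde \<theta> n m = mat m m (\<lambda>(k, l).
     if int l \<ge> int k - 1 then tau \<theta> n (int l - int k) else 0)"

text \<open>The convention for \<open>m = 0\<close> holds because the library's determinant of the
  empty matrix is \<open>1\<close>.\<close>

lemma det_A_tilde_0: "det (A_tilde \<theta> n 0) = 1"
  by (simp add: A_tilde_def)

end

theory Submission
  imports Defs
begin

text \<open>
  Write \<open>g d = (1 + \<bar>d\<bar> w) u^\<bar>d\<bar>\<close> for the kernel of the Toeplitz matrix \<open>R\<close>. On the
  nonpositive integers it is an affine function times the geometric one \<open>u^(-d)\<close>, so there the
  weighted second difference \<open>g k - 2 u g (k + 1) + u^2 g (k + 2)\<close> vanishes: this is the case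
  \<open>k \<le> -2\<close>. What remains of it for \<open>k \<ge> -1\<close> is exactly \<open>\<tau>\<close> at \<open>k\<close>
  (\<open>tau_eq_second_difference\<close>).

  Replacing a row of the reduced matrix by this combination with its two predecessors does not
  change the determinant (\<open>det_add_two_previous_rows\<close>). It produces values of \<open>\<tau>\<close> when the
  three rows are consecutive in \<open>R\<close>; since the second row of \<open>R\<close> is missing, this holds
  from the fourth row of the reduced matrix on. The same gap makes each of these rows sit one place
  higher than in \<open>R\<close>, so that \<open>\<tau>\<close> at \<open>-1\<close> falls on the diagonal and only
  zeros stand to the left of it. If the deleted column is the last but one, the last column sits one
  place further to the left and the last diagonal entry is \<open>\<tau>\<close> at \<open>0\<close> instead; this is the
  determinant of order \<open>n - j\<close> in the formula.

  The determinant therefore splits (\<open>det_lower_rows_triangular\<close>) into the product of these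
  diagonal entries and the leading minor of order three. The latter is formed by the rows
  \<open>1, 3, 4\<close> and the columns \<open>1, 2, 3\<close> of \<open>R\<close>, and the expression in braces is its
  expansion.
\<close>

section \<open>Determinants\<close>

text \<open>The new matrix is the old one multiplied from the left by a lower unitriangular band
  matrix.\<close>

lemma det_add_two_previous_rows:
  fixes A :: "'a::comm_ring_1 mat"
  assumes A: "A \<in> carrier_mat m m" and s: "2 \<le> s"
  shows "det (mat m m (\<lambda>(p, q). if p < s then A $$ (p, q)
           else A $$ (p, q) + a * A $$ (p - 1, q) + b * A $$ (p - 2, q))) = det A"
    (is "det ?B = _")
proof -
  define L where "L = mat m m (\<lambda>(p, r). (if r = p then 1 else 0)
      + (if r = p - 1 then (if s \<le> p then a else 0) else 0)
      + (if r = p - 2 then (if s \<le> p then b else 0) else (0::'a)))"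
  have L: "L \<in> carrier_mat m m"
    by (simp add: L_def)
  have "det L = prod_list (diag_mat L)"
    by (rule det_lower_triangular[OF _ L]) (auto simp: L_def)
  also have "\<dots> = 1"
    unfolding prod_list_diag_prod using s by (intro prod.neutral) (auto simp: L_def)
  finally have detL: "det L = 1" .
  have "?B = L * A"
  proof (rule eq_matI)
    fix p q assume "p < dim_row (L * A)" "q < dim_col (L * A)"
    then have p: "p < m" and q: "q < m"
      using A L by auto
    have "(L * A) $$ (p, q) = (\<Sum>r = 0..<m. L $$ (p, r) * A $$ (r, q))"
      using A L p q by (auto simp: scalar_prod_def intro!: sum.cong)
    also have "\<dots> = (\<Sum>r = 0..<m. (if r = p then A $$ (r, q) else 0)
        + (if r = p - 1 then (if s \<le> p then a else 0) * A $$ (r, q) else 0)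
        + (if r = p - 2 then (if s \<le> p then b else 0) * A $$ (r, q) else 0))"
      using p by (intro sum.cong) (auto simp: L_def algebra_simps)
    also have "\<dots> = A $$ (p, q) + (if s \<le> p then a else 0) * A $$ (p - 1, q)
        + (if s \<le> p then b else 0) * A $$ (p - 2, q)"
      using p by (simp add: sum.distrib less_imp_diff_less)
    finally show "?B $$ (p, q) = (L * A) $$ (p, q)"
      using p q by auto
  qed (use A L in auto)
  then show ?thesis
    using det_mult[OF L A] detL by simp
qed

lemma det_lower_rows_triangular:
  fixes A :: "'a::idom mat"
  assumes A: "A \<in> carrier_mat m m" and s: "s \<le> m"
    and zero: "\<And>p q. s \<le> p \<Longrightarrow> p < m \<Longrightarrow> q < p \<Longrightarrow> A $$ (p, q) = 0"
  shows "det A = det (mat s s (\<lambda>pq. A $$ pq)) * (\<Prod>p = s..<m. A $$ (p, p))"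
proof -
  define D where "D = mat (m - s) (m - s) (\<lambda>(p, q). A $$ (p + s, q + s))"
  have D: "D \<in> carrier_mat (m - s) (m - s)"
    by (simp add: D_def)
  have blocks: "A = four_block_mat (mat s s (\<lambda>pq. A $$ pq))
      (mat s (m - s) (\<lambda>(p, q). A $$ (p, q + s))) (0\<^sub>m (m - s) s) D"
    by (rule eq_matI) (use A s zero in \<open>auto simp: D_def\<close>)
  have "det D = prod_list (diag_mat D)"
    by (rule det_upper_triangular[OF _ D]) (auto simp: D_def intro!: upper_triangularI zero)
  also have "\<dots> = (\<Prod>p = 0..<m - s. A $$ (p + s, p + s))"
    unfolding prod_list_diag_prod by (auto simp: D_def intro!: prod.cong)
  also have "\<dots> = (\<Prod>p = s..<m. A $$ (p, p))"
    using prod.shift_bounds_nat_ivl[of "\<lambda>p. A $$ (p, p)" 0 s "m - s"] s by simp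
  finally have "det D = (\<Prod>p = s..<m. A $$ (p, p))" .
  then show ?thesis
    using det_four_block_mat_lower_left_zero[OF _ _ refl D,
        of "mat s s (\<lambda>pq. A $$ pq)" s "mat s (m - s) (\<lambda>(p, q). A $$ (p, q + s))"]
    by (subst blocks) simp
qed

lemma det_2x2:
  fixes A :: "'a::comm_ring_1 mat"
  assumes "A \<in> carrier_mat 2 2"
  shows "det A = A $$ (0, 0) * A $$ (1, 1) - A $$ (0, 1) * A $$ (1, 0)"
proof -
  have "det A = (\<Sum>q<2. A $$ (0, q) * cofactor A 0 q)"
    using assms by (intro laplace_expansion_row) auto
  also have "\<dots> = A $$ (0, 0) * cofactor A 0 0 + A $$ (0, 1) * cofactor A 0 1"
    by (simp add: numeral_2_eq_2)
  finally have expand: "det A = \<dots>" .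
  have "det (mat_delete A 0 q) = mat_delete A 0 q $$ (0, 0)" for q
    using mat_delete_carrier[OF assms, of 0 q] by (intro det_single) simp
  then have cofactor: "cofactor A 0 q = (- 1) ^ q * A $$ (1, if 0 < q then 0 else 1)" for q
    using assms by (simp add: cofactor_def mat_delete_def)
  show ?thesis
    unfolding expand cofactor by simp
qed

lemma det_3x3:
  fixes A :: "'a::comm_ring_1 mat"
  assumes "A \<in> carrier_mat 3 3"
  shows "det A = A $$ (0, 0) * (A $$ (1, 1) * A $$ (2, 2) - A $$ (1, 2) * A $$ (2, 1))
    - A $$ (0, 1) * (A $$ (1, 0) * A $$ (2, 2) - A $$ (1, 2) * A $$ (2, 0))
    + A $$ (0, 2) * (A $$ (1, 0) * A $$ (2, 1) - A $$ (1, 1) * A $$ (2, 0))"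
proof -
  have "det A = (\<Sum>q<3. A $$ (0, q) * cofactor A 0 q)"
    using assms by (intro laplace_expansion_row) auto
  also have "\<dots> = A $$ (0, 0) * cofactor A 0 0 + A $$ (0, 1) * cofactor A 0 1
      + A $$ (0, 2) * cofactor A 0 2"
    by (simp add: numeral_3_eq_3 numeral_2_eq_2)
  finally have expand: "det A = \<dots>" .
  have "det (mat_delete A 0 q) = mat_delete A 0 q $$ (0, 0) * mat_delete A 0 q $$ (1, 1)
      - mat_delete A 0 q $$ (0, 1) * mat_delete A 0 q $$ (1, 0)" for q
    using mat_delete_carrier[OF assms, of 0 q] by (intro det_2x2) simp
  then have cofactor: "cofactor A 0 q = (- 1) ^ q *
      (A $$ (1, if 0 < q then 0 else 1) * A $$ (2, if 1 < q then 1 else 2)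
      - A $$ (1, if 1 < q then 1 else 2) * A $$ (2, if 0 < q then 0 else 1))" for q
    using assms by (simp add: cofactor_def mat_delete_def numeral_2_eq_2)
  show ?thesis
    unfolding expand cofactor by (simp add: algebra_simps)
qed

section \<open>The kernel of the Toeplitz matrix and its second difference\<close>

text \<open>The Matern correlation function of smoothness \<open>3/2\<close>, sampled with step \<open>w\<close>: for
  \<open>u = exp (- w)\<close> its value at \<open>d\<close> is \<open>(1 + t) exp (- t)\<close> with \<open>t = \<bar>d\<bar> w\<close>.\<close>

definition matern :: "real \<Rightarrow> real \<Rightarrow> int \<Rightarrow> real"
  where "matern w u d = (1 + of_int \<bar>d\<bar> * w) * u ^ nat \<bar>d\<bar>"

lemma matern_minus: "matern w u (- d) = matern w u d"
  by (simp add: matern_def)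

lemma matern_of_nat: "matern w u (int d) = (1 + real d * w) * u ^ d"
  by (simp add: matern_def)

text \<open>For \<open>k \<le> -2\<close> all three arguments are nonpositive. There \<open>matern w u d\<close> is
  \<open>(1 - d w) u^(-d)\<close>, so the three terms share the factor \<open>u^(-k)\<close>, and what is left is the
  second difference of an affine function.\<close>

lemma tau_eq_second_difference:
  fixes \<theta> :: real and n :: nat
  defines "w \<equiv> w_par \<theta> n" and "u \<equiv> u_par \<theta> n"
  shows "matern w u k - 2 * u * matern w u (k + 1) + u\<^sup>2 * matern w u (k + 2) = tau \<theta> n k"
proof -
  have "k = int (nat k)" if "k \<ge> 0"
    using that by simp
  moreover have "k = - int (nat (- k - 2) + 2)" if "k \<le> -2"
    using that by simp
  moreover have "k \<ge> 0 \<or> k = -1 \<or> k \<le> -2"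
    by linarith
  ultimately consider (nonneg) d where "k = int d" | (minus_one) "k = -1"
    | (neg) d where "k = - int (d + 2)"
    by metis
  then show ?thesis
  proof cases
    case nonneg
    have "matern w u (k + 1) = (1 + (real d + 1) * w) * u ^ (d + 1)"
      and "matern w u (k + 2) = (1 + (real d + 2) * w) * u ^ (d + 2)"
      using nonneg matern_of_nat[of w u "d + 1"] matern_of_nat[of w u "d + 2"]
      by (simp_all only: of_nat_add of_nat_1 of_nat_numeral)
    moreover have "matern w u k = (1 + real d * w) * u ^ d"
      using nonneg by (simp only: matern_of_nat)
    moreover have "tau \<theta> n k = (1 + real d * w) * u ^ d - 2 * (1 + (real d + 1) * w) * u ^ (d + 2)
        + (1 + (real d + 2) * w) * u ^ (d + 4)"
      using nonneg by (simp add: tau_def Let_def w_def u_def)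
    ultimately show ?thesis
      by (simp add: power_add power2_eq_square power4_eq_xxxx algebra_simps)
  next
    case minus_one
    then show ?thesis
      by (simp add: matern_def tau_def Let_def w_def[symmetric] u_def[symmetric]
          power2_eq_square power3_eq_cube algebra_simps)
  next
    case neg
    have "k + 1 = - int (d + 1)" and "k + 2 = - int d"
      using neg by simp_all
    then have "matern w u k = (1 + (real d + 2) * w) * u ^ (d + 2)"
      and "matern w u (k + 1) = (1 + (real d + 1) * w) * u ^ (d + 1)"
      and "matern w u (k + 2) = (1 + real d * w) * u ^ d"
      using neg matern_minus matern_of_nat[of w u "d + 2"] matern_of_nat[of w u "d + 1"]
        matern_of_nat[of w u d] by (simp_all only: of_nat_add of_nat_1 of_nat_numeral)
    moreover have "tau \<theta> n k = 0"
      using neg by (simp add: tau_def)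
    ultimately show ?thesis
      by (simp add: power_add power2_eq_square algebra_simps)
  qed
qed

lemma tau_eq_0: "k \<le> -2 \<Longrightarrow> tau \<theta> n k = 0"
  by (simp add: tau_def)

section \<open>The matrix without its second row and one column\<close>

lemma submatrix_lessThan_dims:
  assumes "A \<in> carrier_mat m k"
  shows "submatrix A {..<m} {..<k} = A"
proof -
  have pick: "pick {..<m} p = p" if "p < m" for m p :: nat
  proof -
    have "{a \<in> {..<m}. a < p} = {..<p}"
      using that by auto
    then show ?thesis
      using pick_card_in_set[of p "{..<m}"] that by simp
  qed
  show ?thesis
    by (rule eq_matI) (use assms pick in \<open>auto simp: submatrix_def\<close>)
qed

lemma R_mat_eq:
  "R_mat \<theta> n = mat n n (\<lambda>(k, l). matern (w_par \<theta> n) (u_par \<theta> n) (int k - int l))"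
  by (simp only: R_mat_def matern_def)

lemma R_minus_leading_2_eq:
  "R_minus_leading \<theta> n 2 j (n - 1) = mat (n - 1) (n - 1) (\<lambda>(p, q).
     matern (w_par \<theta> n) (u_par \<theta> n)
       (int (if p < 1 then p else Suc p) - int (if q < j - 1 then q else Suc q)))"
proof -
  have "R_minus \<theta> n 2 j \<in> carrier_mat (n - 1) (n - 1)"
    unfolding R_minus_def by (rule mat_delete_carrier) (simp add: R_mat_def)
  then have "R_minus_leading \<theta> n 2 j (n - 1) = R_minus \<theta> n 2 j"
    by (simp add: R_minus_leading_def submatrix_lessThan_dims)
  then show ?thesis
    by (intro eq_matI) (auto simp: R_minus_def mat_delete_def R_mat_eq)
qed

theorem theorem3:
  fixes \<theta> :: real and n j :: nat
  assumes "\<theta> > 0" and "n \<ge> 1"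
    and "n - 1 \<le> j" and "j \<le> n"
    and "j \<ge> 4"
  shows "det (R_minus_leading \<theta> n 2 j (n - 1)) =
    tau \<theta> n (-1) ^ (j - 4) *
      (tau_tilde_m2 \<theta> n * ((1 + 2 * w_par \<theta> n)\<^sup>2 * u_par \<theta> n ^ 4 - 1)
        + tau_tilde_m1 \<theta> n * tau_star_1 \<theta> n) *
      det (A_tilde \<theta> n (n - j))"
proof -
  define w u where "w = w_par \<theta> n" and "u = u_par \<theta> n"
  define col where "col q = (if q < j - 1 then q else Suc q)" for q
  define A where "A = R_minus_leading \<theta> n 2 j (n - 1)"
  define B where "B = mat (n - 1) (n - 1) (\<lambda>(p, q). if p < 3 then A $$ (p, q)
    else A $$ (p, q) + (- 2 * u) * A $$ (p - 1, q) + u\<^sup>2 * A $$ (p - 2, q))"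
  have A: "A \<in> carrier_mat (n - 1) (n - 1)"
    unfolding A_def R_minus_leading_2_eq by simp
  have B: "B \<in> carrier_mat (n - 1) (n - 1)"
    by (simp add: B_def)
  have A_entry: "A $$ (p, q) = matern w u (int (if p < 1 then p else Suc p) - int (col q))"
    if "p < n - 1" "q < n - 1" for p q
    unfolding A_def R_minus_leading_2_eq w_def u_def col_def using that by simp
  have B_entry: "B $$ (p, q) = tau \<theta> n (int (col q) - int (p + 1))"
    if p: "3 \<le> p" "p < n - 1" and q: "q < n - 1" for p q
  proof -
    \<comment> \<open>Since the kernel is even, its argument may be read as column minus row, which grows by one
      when moving up one row.\<close>
    define k where "k = int (col q) - int (p + 1)"
    have "A $$ (p, q) = matern w u (- k)" "A $$ (p - 1, q) = matern w u (- (k + 1))"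
      "A $$ (p - 2, q) = matern w u (- (k + 2))"
      using p q by (auto simp: A_entry k_def intro!: arg_cong[where f = "matern w u"])
    moreover have "B $$ (p, q) = A $$ (p, q) + (- 2 * u) * A $$ (p - 1, q) + u\<^sup>2 * A $$ (p - 2, q)"
      using p q by (simp add: B_def)
    ultimately have "B $$ (p, q)
        = matern w u k - 2 * u * matern w u (k + 1) + u\<^sup>2 * matern w u (k + 2)"
      by (simp only: matern_minus)
    then show ?thesis
      by (simp only: tau_eq_second_difference w_def u_def k_def)
  qed

  \<comment> \<open>Rows are counted from \<open>0\<close>, so \<open>p = 3\<close> is the fourth row; its two predecessors
    are the third and fourth rows of \<open>R\<close>, both beyond the gap.\<close>
  have "det A = det B"
    unfolding B_def by (rule det_add_two_previous_rows[OF A, symmetric]) simp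
  also have "\<dots> = det (mat 3 3 (\<lambda>pq. B $$ pq)) * (\<Prod>p = 3..<n - 1. B $$ (p, p))"
  proof (rule det_lower_rows_triangular[OF B])
    show "3 \<le> n - 1"
      using assms by simp
    fix p q assume pq: "3 \<le> p" "p < n - 1" "q < p"
    \<comment> \<open>The column \<open>q\<close> lies to the left of the deleted one, hence keeps its number.\<close>
    then have "col q = q"
      using assms by (auto simp: col_def)
    then show "B $$ (p, q) = 0"
      using pq by (simp add: B_entry tau_eq_0)
  qed
  also have "(\<Prod>p = 3..<n - 1. B $$ (p, p)) = tau \<theta> n (-1) ^ (j - 4) * det (A_tilde \<theta> n (n - j))"
  proof -
    have "(\<Prod>p = 3..<n - 1. B $$ (p, p)) = (\<Prod>p = 3..<n - 1. tau \<theta> n (if p < j - 1 then -1 else 0))"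
      by (intro prod.cong refl) (auto simp: B_entry col_def)
    also have "\<dots> = (\<Prod>p = 3..<j - 1. tau \<theta> n (if p < j - 1 then -1 else 0))
        * (\<Prod>p = j - 1..<n - 1. tau \<theta> n (if p < j - 1 then -1 else 0))"
      using assms by (intro prod.atLeastLessThan_concat[symmetric]) auto
    also have "\<dots> = tau \<theta> n (-1) ^ (j - 4) * tau \<theta> n 0 ^ (n - j)"
      using assms by simp
    also have "tau \<theta> n 0 ^ (n - j) = det (A_tilde \<theta> n (n - j))"
    proof (cases "n - j = 0")
      case True
      then show ?thesis
        by (simp add: det_A_tilde_0)
    next
      case False
      then have "n - j = 1"
        using assms by simp
      then show ?thesis
        using det_single[of "A_tilde \<theta> n 1"] by (simp add: A_tilde_def)
    qed
    finally show ?thesis .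
  qed
  also have "det (mat 3 3 (\<lambda>pq. B $$ pq)) =
      tau_tilde_m2 \<theta> n * ((1 + 2 * w)\<^sup>2 * u ^ 4 - 1) + tau_tilde_m1 \<theta> n * tau_star_1 \<theta> n"
  proof -
    have "det (mat 3 3 (\<lambda>pq. B $$ pq)) = det (mat 3 3 (\<lambda>(p, q).
        matern w u (int (if p < 1 then p else Suc p) - int q)))"
      by (rule arg_cong[where f = det], rule eq_matI)
        (use assms in \<open>auto simp: B_def A_entry col_def\<close>)
    also have "\<dots> =
        1 * ((1 + w) * u * ((1 + w) * u) - 1 * ((1 + 2 * w) * u\<^sup>2))
        - (1 + w) * u * ((1 + 2 * w) * u\<^sup>2 * ((1 + w) * u) - 1 * ((1 + 3 * w) * u ^ 3))
        + (1 + 2 * w) * u\<^sup>2 *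
          ((1 + 2 * w) * u\<^sup>2 * ((1 + 2 * w) * u\<^sup>2) - (1 + w) * u * ((1 + 3 * w) * u ^ 3))"
      by (subst det_3x3) (simp_all add: matern_def)
    also have "\<dots> = tau_tilde_m2 \<theta> n * ((1 + 2 * w)\<^sup>2 * u ^ 4 - 1)
        + tau_tilde_m1 \<theta> n * tau_star_1 \<theta> n" (is "?minor = ?braces")
    proof -
      have "2 * ?braces = (2 * tau_tilde_m2 \<theta> n) * ((1 + 2 * w)\<^sup>2 * u ^ 4 - 1)
          + (2 * tau_tilde_m1 \<theta> n) * tau_star_1 \<theta> n"
        by (simp only: distrib_left mult.assoc)
      also have "\<dots> = ((w - 1) * u + (1 + w) * u ^ 3) * u * ((1 + 2 * w)\<^sup>2 * u ^ 4 - 1)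
          + ((2 * w - 1) * u + (1 + 2 * w) * u ^ 5) * ((1 + w) * u - (1 + w) * (1 + 2 * w) * u ^ 3)"
        by (simp add: tau_tilde_m2_def tau_tilde_m1_def tau_star_1_def tau_def Let_def w_def u_def)
      also have "\<dots> = 2 * ?minor"
      proof -
        have "u ^ 5 = u * u * u * u * u"
          by (simp add: eval_nat_numeral)
        then show ?thesis
          by (simp add: power2_eq_square power3_eq_cube power4_eq_xxxx ring_distribs)
      qed
      finally show ?thesis
        by simp
    qed
    finally show ?thesis .
  qed
  finally show ?thesis
    by (simp add: A_def w_def u_def mult_ac)
qed

end
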